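(* Let $(X,r)$ be a right-non-degenerate (RND) solution, and let $k$ be a reflection for $(X,r)$. The $k$-guitar maps $J^{n;k}$ ($n\ge 0$) induce a bijection of $\mathbb{Z}_{\ge 0}$-graded sets $$\overline{J^{(k)}}\colon M(X,r)\to M(X,r^{(k)}),$$ sending the class of a word $\overline{a}\in X^n$ to the class of $J^{n;k}(\overline{a})$. Further, the $k$-Garside maps $\Delta^{n;k}$ induce a map of $\mathbb{Z}_{\ge 0}$-graded sets $$\overline{\Delta^{(k)}}\colon M(X,r)\to M(X,r),$$ sending the class of $\overline{a}\in X^n$ to the class of $\Delta^{n;k}(\overline{a})$.
   Context: Products of maps denote composition, the rightmost map being applied first. For a map $\phi\colon X^m\to X^m$, $\phi_i$ denotes the map on $X^n$ that applies $\phi$ to the $m$ consecutive coordinates starting at position $i$ and is the identity on the others. A solution $(X,r)$ is a set $X$ with a map $r\colon X\times X\to X\times X$ (not assumed bijective) satisfying the Yang–Baxter equation $r_1r_2r_1=r_2r_1r_2$ on $X^3$; write $r(a,b)=(\lambda_a(b),\rho_b(a))$. It is right-non-degenerate (RND) if all maps $\rho_b\colon X\to X$ are bijective. A reflection for $(X,r)$ is a map $k\colon X\to X$ with $r k_2 r k_2=k_2 r k_2 r$ on $X^2$. The structure monoid of a solution is $M(X,r)=\langle a\in X\mid ab=\lambda_a(b)\rho_b(a)\text{ for all }a,b\in X\rangle$, graded by word length; elements of $X^n$ are viewed as words of length $n$. For an RND solution and a reflection $k$, the $k$-derived solution is the map $r^{(k)}\colon X\times X\to X\times X$, $r^{(k)}(a,b)=(b',a')$,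 where $a'=\rho_b\rho_{k(b)}^{-1}(a)$ and $b'=\rho_{k(a')}\lambda_{\rho_{k(b)}^{-1}(a)}(b)$. It is again an RND solution. The $k$-Garside maps $\Delta^{n;k}\colon X^n\to X^n$ are $$\Delta^{n;k}=k_n\,(r_{n-1}\cdots r_2r_1)\,k_n\cdots k_n\,(r_{n-1}r_{n-2})\,k_n\,r_{n-1}\,k_n,$$ that is, $\Delta^{1;k}=k$ and $\Delta^{n;k}=k_n\, r_{n-1}\cdots r_2 r_1\,(\mathrm{Id}_X\times\Delta^{n-1;k})$ for $n\ge 2$. Put $\rho_{(b_1,\ldots,b_m)}=\rho_{b_m}\cdots\rho_{b_2}\rho_{b_1}$. The $k$-guitar maps $J^{n;k}\colon X^n\to X^n$ send $(a_1,\ldots,a_n)$ to $$\bigl(\rho_{\Delta^{n-1;k}(a_2,\ldots,a_n)}(a_1),\ \rho_{\Delta^{n-2;k}(a_3,\ldots,a_n)}(a_2),\ \ldots,\ \rho_{\Delta^{2;k}(a_{n-1},a_n)}(a_{n-2}),\ \rho_{k(a_n)}(a_{n-1}),\ a_n\bigr).$$ For $n=0$ both maps are the identity of the one-point set $X^0$. *)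

theory Defs
  imports "HOL-Algebra.Group"
begin

text \<open>
  The underlying set of a solution is the type \<^typ>\<open>'a\<close>, and \<open>X\<^sup>n\<close> is the set of lists of length
  \<open>n\<close>. Families of maps \<open>X\<^sup>n \<rightarrow> X\<^sup>n\<close> indexed by \<open>n\<close> are given as one length-preserving map on lists.
  Coordinates are numbered from \<open>1\<close>.
\<close>

definition lam :: "('a \<times> 'a \<Rightarrow> 'a \<times> 'a) \<Rightarrow> 'a \<Rightarrow> 'a \<Rightarrow> 'a" where
  "lam r a b = fst (r (a, b))"

definition rho :: "('a \<times> 'a \<Rightarrow> 'a \<times> 'a) \<Rightarrow> 'a \<Rightarrow> 'a \<Rightarrow> 'a" where
  "rho r b a = snd (r (a, b))"

text \<open>\<open>act1 k i\<close> is \<open>k\<^sub>i\<close> and \<open>act2 r i\<close> is \<open>r\<^sub>i\<close>, applied to coordinate \<open>i\<close> and to coordinates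
  \<open>i, i + 1\<close> respectively; they are meaningful when these coordinates exist.\<close>

definition act1 :: "('a \<Rightarrow> 'a) \<Rightarrow> nat \<Rightarrow> 'a list \<Rightarrow> 'a list" where
  "act1 k i w = w[i - 1 := k (w ! (i - 1))]"

definition act2 :: "('a \<times> 'a \<Rightarrow> 'a \<times> 'a) \<Rightarrow> nat \<Rightarrow> 'a list \<Rightarrow> 'a list" where
  "act2 r i w = (let (c, d) = r (w ! (i - 1), w ! i) in w[i - 1 := c, i := d])"

definition solution :: "('a \<times> 'a \<Rightarrow> 'a \<times> 'a) \<Rightarrow> bool" where
  "solution r \<longleftrightarrow> (\<forall>w. length w = 3 \<longrightarrow>
     act2 r 1 (act2 r 2 (act2 r 1 w)) = act2 r 2 (act2 r 1 (act2 r 2 w)))"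

definition right_nondegenerate :: "('a \<times> 'a \<Rightarrow> 'a \<times> 'a) \<Rightarrow> bool" where
  "right_nondegenerate r \<longleftrightarrow> (\<forall>b. bij (rho r b))"

definition reflection :: "('a \<times> 'a \<Rightarrow> 'a \<times> 'a) \<Rightarrow> ('a \<Rightarrow> 'a) \<Rightarrow> bool" where
  "reflection r k \<longleftrightarrow> (\<forall>w. length w = 2 \<longrightarrow>
     act2 r 1 (act1 k 2 (act2 r 1 (act1 k 2 w))) = act1 k 2 (act2 r 1 (act1 k 2 (act2 r 1 w))))"

text \<open>The inverse below is genuine when \<open>r\<close> is right-non-degenerate.\<close>

definition derived_solution ::
  "('a \<times> 'a \<Rightarrow> 'a \<times> 'a) \<Rightarrow> ('a \<Rightarrow> 'a) \<Rightarrow> 'a \<times> 'a \<Rightarrow> 'a \<times> 'a" where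
  "derived_solution r k = (\<lambda>(a, b).
     let c = inv_into UNIV (rho r (k b)) a;
         a' = rho r b c;
         b' = rho r (k a') (lam r c b)
     in (b', a'))"

text \<open>The structure monoid: the quotient of the free monoid of words by the congruence generated by
  the defining relations.\<close>

inductive struct_cong :: "('a \<times> 'a \<Rightarrow> 'a \<times> 'a) \<Rightarrow> 'a list \<Rightarrow> 'a list \<Rightarrow> bool"
  for r :: "'a \<times> 'a \<Rightarrow> 'a \<times> 'a" where
  generator: "struct_cong r [a, b] [lam r a b, rho r b a]"
| refl: "struct_cong r u u"
| sym: "struct_cong r u v \<Longrightarrow> struct_cong r v u"
| trans: "struct_cong r u v \<Longrightarrow> struct_cong r v w \<Longrightarrow> struct_cong r u w"
| append: "struct_cong r u u' \<Longrightarrow> struct_cong r v v' \<Longrightarrow> struct_cong r (u @ v) (u' @ v')"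

definition struct_rel :: "('a \<times> 'a \<Rightarrow> 'a \<times> 'a) \<Rightarrow> ('a list \<times> 'a list) set" where
  "struct_rel r = {(u, v). struct_cong r u v}"

definition word_class :: "('a \<times> 'a \<Rightarrow> 'a \<times> 'a) \<Rightarrow> 'a list \<Rightarrow> 'a list set" where
  "word_class r w = struct_rel r `` {w}"

definition structure_monoid :: "('a \<times> 'a \<Rightarrow> 'a \<times> 'a) \<Rightarrow> 'a list set monoid" where
  "structure_monoid r =
     \<lparr>carrier = UNIV // struct_rel r,
      mult = (\<lambda>A B. \<Union>u\<in>A. \<Union>v\<in>B. word_class r (u @ v)),
      one = word_class r []\<rparr>"

definition degree_part :: "('a \<times> 'a \<Rightarrow> 'a \<times> 'a) \<Rightarrow> nat \<Rightarrow> 'a list set set" where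
  "degree_part r n = word_class r ` {w. length w = n}"

lemma equiv_struct_rel: "equiv UNIV (struct_rel r)"
  by (rule equivI)
    (auto simp: struct_rel_def refl_on_def sym_def trans_def
      intro: struct_cong.refl struct_cong.sym struct_cong.trans)

lemma word_class_eq_iff: "word_class r u = word_class r v \<longleftrightarrow> struct_cong r u v"
  using eq_equiv_class_iff[OF equiv_struct_rel, of u v r]
  by (simp add: word_class_def struct_rel_def)

lemma mem_word_class_iff: "v \<in> word_class r u \<longleftrightarrow> struct_cong r u v"
  by (simp add: word_class_def struct_rel_def)

lemma carrier_structure_monoid: "carrier (structure_monoid r) = range (word_class r)"
  by (auto simp: structure_monoid_def quotient_def word_class_def)

lemma mult_word_class:
  "word_class r u \<otimes>\<^bsub>structure_monoid r\<^esub> word_class r v = word_class r (u @ v)"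
proof -
  have "word_class r (u' @ v') = word_class r (u @ v)"
    if "u' \<in> word_class r u" "v' \<in> word_class r v" for u' v'
    using that by (meson mem_word_class_iff word_class_eq_iff struct_cong.append struct_cong.sym)
  then have "(\<Union>u'\<in>word_class r u. \<Union>v'\<in>word_class r v. word_class r (u' @ v')) =
      (\<Union>u'\<in>word_class r u. \<Union>v'\<in>word_class r v. word_class r (u @ v))"
    by (intro SUP_cong HOL.refl) blast
  also have "\<dots> = word_class r (u @ v)"
  proof -
    have "word_class r u \<noteq> {}" "word_class r v \<noteq> {}"
      using mem_word_class_iff struct_cong.refl by fastforce+
    then show ?thesis by simp
  qed
  finally show ?thesis
    by (simp add: structure_monoid_def)
qed

lemma monoid_structure_monoid: "monoid (structure_monoid r)"
proof -
  have one: "\<one>\<^bsub>structure_monoid r\<^esub> = word_class r []"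
    by (simp add: structure_monoid_def)
  show ?thesis
    by (rule monoidI) (auto simp: carrier_structure_monoid mult_word_class one)
qed

lemma struct_cong_length: "struct_cong r u v \<Longrightarrow> length u = length v"
  by (induction rule: struct_cong.induct) auto

lemma carrier_eq_Union_degree_part: "carrier (structure_monoid r) = (\<Union>n. degree_part r n)"
  by (auto simp: carrier_structure_monoid degree_part_def)

lemma disjoint_degree_part: "m \<noteq> n \<Longrightarrow> degree_part r m \<inter> degree_part r n = {}"
  by (auto simp: degree_part_def word_class_eq_iff dest: struct_cong_length)

text \<open>\<open>garside r k\<close> restricted to words of length \<open>n\<close> is \<open>\<Delta>\<^sup>n\<^sup>;\<^sup>k\<close>. The fold is
  \<open>r\<^sub>n\<^sub>-\<^sub>1 \<cdots> r\<^sub>2 r\<^sub>1\<close>, with \<open>r\<^sub>1\<close> applied first, where \<open>n = length w + 1\<close>; for \<open>n = 1\<close> it is the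
  identity and \<open>\<Delta>\<^sup>1\<^sup>;\<^sup>k\<close> comes out as \<open>k\<close>.\<close>

primrec garside :: "('a \<times> 'a \<Rightarrow> 'a \<times> 'a) \<Rightarrow> ('a \<Rightarrow> 'a) \<Rightarrow> 'a list \<Rightarrow> 'a list" where
  "garside r k [] = []"
| "garside r k (a # w) =
     act1 k (length w + 1) (fold (act2 r) [1..<length w + 1] (a # garside r k w))"

text \<open>\<open>rho_word r [b\<^sub>1, \<dots>, b\<^sub>m]\<close> is \<open>\<rho>\<^bsub>b\<^sub>m\<^esub> \<cdots> \<rho>\<^bsub>b\<^sub>1\<^esub>\<close>.\<close>

definition rho_word :: "('a \<times> 'a \<Rightarrow> 'a \<times> 'a) \<Rightarrow> 'a list \<Rightarrow> 'a \<Rightarrow> 'a" where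
  "rho_word r bs = fold (rho r) bs"

primrec guitar :: "('a \<times> 'a \<Rightarrow> 'a \<times> 'a) \<Rightarrow> ('a \<Rightarrow> 'a) \<Rightarrow> 'a list \<Rightarrow> 'a list" where
  "guitar r k [] = []"
| "guitar r k (a # w) = rho_word r (garside r k w) a # guitar r k w"

lemma length_act1 [simp]: "length (act1 k i w) = length w"
  by (simp add: act1_def)

lemma length_act2 [simp]: "length (act2 r i w) = length w"
  by (simp add: act2_def split: prod.split)

lemma length_fold_act2 [simp]: "length (fold (act2 r) is w) = length w"
  by (induction "is" arbitrary: w) auto

lemma length_garside [simp]: "length (garside r k w) = length w"
  by (induction w) auto

lemma length_guitar [simp]: "length (guitar r k w) = length w"
  by (induction w) auto

lemma garside_singleton: "garside r k [a] = [k a]"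
  by (simp add: act1_def)

end

theory Submission imports Defs begin

text \<open>
  Read a word from left to right as strands of a braid diagram, with \<open>r\<close> acting on a crossing and
  \<open>k\<close> on a strand that bounces off a wall to the right of the diagram. The map \<open>\<Delta>\<close> builds up by
  letting each new letter \<open>a\<close> cross everything that \<open>\<Delta>\<close> has already produced and then bounce:
  this is the recursive function \<open>sweep\<close> below, and \<open>\<Delta>(a w) = sweep a (\<Delta> w)\<close>. Processing the
  word letter by letter reduces all claims to one crossing.

  \<^item> \<^emph>\<open>\<open>\<Delta>\<close> is compatible with the relations.\<close> If \<open>r(a, b) = (c, d)\<close>, then sweeping \<open>b\<close> and then
    \<open>a\<close> through a word \<open>v\<close> is equivalent to sweeping \<open>d\<close> and then \<open>c\<close>: by the Yang--Baxter
    equation the crossing of the two letters travels with them along \<open>v\<close>, and when they reach the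
    wall the reflection equation turns it into a crossing of the two reflected letters
    (\<open>sweep_sweep_cong\<close>). Moreover, sweeping a letter through equivalent words gives equivalent
    results (\<open>sweep_cong\<close>).

  \<^item> \<^emph>\<open>\<open>J\<close> intertwines \<open>r\<close> with \<open>r\<^sup>(\<^sup>k\<^sup>)\<close>.\<close> The equality \<open>J r\<^sub>i = r\<^sup>(\<^sup>k\<^sup>)\<^sub>i J\<close> holds already on words
    (\<open>guitar_step\<close>). Entries of \<open>J\<close> to the right of the crossing do not see it; entries to the left
    depend only on the class of \<open>\<Delta>\<close> of the suffix, as \<open>\<rho>\<close> is a right action of the structure
    monoid. For the two entries at the crossing, the same travelling argument reduces the claim to
    the crossing at the end of the word, where it is the formula defining \<open>r\<^sup>(\<^sup>k\<^sup>)\<close>.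

  Right non-degeneracy makes \<open>J\<close> a bijection on words of each length, so the intertwining relation can
  also be read backwards: \<open>J\<close> preserves and reflects the defining relations of the two monoids.
\<close>

section \<open>Words up to the defining relations\<close>

lemma struct_cong_pair: "r (a, b) = (c, d) \<Longrightarrow> struct_cong r [a, b] [c, d]"
  using struct_cong.generator[of r a b] by (simp add: lam_def rho_def)

lemma struct_cong_context: "struct_cong r u v \<Longrightarrow> struct_cong r (p @ u @ s) (p @ v @ s)"
  by (intro struct_cong.append struct_cong.refl)

lemma struct_cong_Cons: "struct_cong r u v \<Longrightarrow> struct_cong r (a # u) (a # v)"
  using struct_cong_context[of r u v "[a]" "[]"] by simp

text \<open>The structure congruence is the equivalence relation generated by single rewriting steps
  inside a word. This form lets one test an equivalence relation \<open>P\<close> that need not be a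
  congruence, such as a kernel of a map that does not respect concatenation.\<close>

lemma struct_cong_step_induct [consumes 1, case_names step refl sym trans]:
  assumes cong: "struct_cong r u v"
    and step: "\<And>p a b c d s. r (a, b) = (c, d) \<Longrightarrow> P (p @ [a, b] @ s) (p @ [c, d] @ s)"
    and refl: "\<And>w. P w w"
    and sym: "\<And>x y. P x y \<Longrightarrow> P y x"
    and trans: "\<And>x y z. P x y \<Longrightarrow> P y z \<Longrightarrow> P x z"
  shows "P u v"
proof -
  have "P (p @ u @ s) (p @ v @ s)" for p s
    using cong
  proof (induction arbitrary: p s rule: struct_cong.induct)
    case (generator a b)
    show ?case
      by (rule step) (simp add: lam_def rho_def)
  next
    case (append u u' v v')
    have "P (p @ u @ v @ s) (p @ u' @ v @ s)"
      using append.IH(1)[of p "v @ s"] by simp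
    moreover have "P (p @ u' @ v @ s) (p @ u' @ v' @ s)"
      using append.IH(2)[of "p @ u'" s] by simp
    ultimately show ?case
      using trans by fastforce
  qed (blast intro: refl sym trans)+
  from this[of "[]" "[]"] show ?thesis
    by simp
qed

lemma word_class_map_exists:
  assumes "\<And>u v. struct_cong r u v \<Longrightarrow> struct_cong r' (f u) (f v)"
  shows "\<exists>F. \<forall>w. F (word_class r w) = word_class r' (f w)"
proof (intro exI allI)
  fix w
  have "w \<in> word_class r w"
    by (simp add: mem_word_class_iff struct_cong.refl)
  then have "(SOME u. u \<in> word_class r w) \<in> word_class r w"
    by (rule someI)
  then have "struct_cong r' (f w) (f (SOME u. u \<in> word_class r w))"
    by (simp add: mem_word_class_iff assms)
  then show "(\<lambda>A. word_class r' (f (SOME u. u \<in> A))) (word_class r w) = word_class r' (f w)"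
    by (simp add: word_class_eq_iff struct_cong.sym)
qed

lemma degree_part_image_subset:
  assumes "\<And>w. F (word_class r w) = word_class r' (f w)" and "\<And>w. length (f w) = length w"
  shows "F ` degree_part r n \<subseteq> degree_part r' n"
  using assms by (auto simp: degree_part_def)

section \<open>The Yang--Baxter and reflection equations in coordinates\<close>

lemma yang_baxter_coordinates:
  assumes "solution r"
  shows yang_baxter_left: "lam r (lam r a b) (lam r (rho r b a) c) = lam r a (lam r b c)"
    and yang_baxter_middle:
      "rho r (lam r (rho r b a) c) (lam r a b) = lam r (rho r (lam r b c) a) (rho r c b)"
    and yang_baxter_right: "rho r (rho r c b) (rho r (lam r b c) a) = rho r c (rho r b a)"
proof -
  have "act2 r 1 (act2 r 2 (act2 r 1 [a, b, c])) = act2 r 2 (act2 r 1 (act2 r 2 [a, b, c]))"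
    using assms by (simp add: solution_def)
  then show "lam r (lam r a b) (lam r (rho r b a) c) = lam r a (lam r b c)"
    "rho r (lam r (rho r b a) c) (lam r a b) = lam r (rho r (lam r b c) a) (rho r c b)"
    "rho r (rho r c b) (rho r (lam r b c) a) = rho r c (rho r b a)"
    by (simp_all add: act2_def lam_def rho_def split_beta numeral_2_eq_2)
qed

text \<open>The Yang--Baxter equation lets a crossing slide past a third strand \<open>x\<close>. In this form, the
  displaced letters satisfy the hypothesis on \<open>a, b, c, d\<close> again, so that it can serve as the step of
  an induction over a word whose first letter is \<open>x\<close>.\<close>

lemma crossing_travels:
  assumes "solution r" and "r (a, b) = (c, d)"
  shows "r (rho r (lam r b x) a, rho r x b) = (rho r (lam r d x) c, rho r x d)"
    and "lam r a (lam r b x) = lam r c (lam r d x)"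
proof -
  have cd: "c = lam r a b" "d = rho r b a"
    using assms(2) by (simp_all add: lam_def rho_def)
  have r: "r (y, z) = (lam r y z, rho r z y)" for y z
    by (simp add: lam_def rho_def)
  show "r (rho r (lam r b x) a, rho r x b) = (rho r (lam r d x) c, rho r x d)"
    by (simp add: r cd yang_baxter_middle[OF assms(1)] yang_baxter_right[OF assms(1)])
  show "lam r a (lam r b x) = lam r c (lam r d x)"
    by (simp add: cd yang_baxter_left[OF assms(1)])
qed

lemma reflection_coordinates:
  assumes "reflection r k" and "r (a, b) = (c, d)"
  shows "r (lam r a (k b), k (rho r (k b) a)) = (lam r c (k d), k (rho r (k d) c))"
proof -
  have "act2 r 1 (act1 k 2 (act2 r 1 (act1 k 2 [a, b])))
      = act1 k 2 (act2 r 1 (act1 k 2 (act2 r 1 [a, b])))"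
    using assms(1) by (simp add: reflection_def)
  then show ?thesis
    using assms(2) by (simp add: act1_def act2_def lam_def rho_def split_beta prod_eq_iff)
qed

section \<open>The action of words on letters\<close>

lemma rho_word_Nil [simp]: "rho_word r [] a = a"
  by (simp add: rho_word_def)

lemma rho_word_Cons [simp]: "rho_word r (b # w) a = rho_word r w (rho r b a)"
  by (simp add: rho_word_def)

lemma rho_word_append: "rho_word r (u @ v) a = rho_word r v (rho_word r u a)"
  by (simp add: rho_word_def)

text \<open>The third coordinate of the Yang--Baxter equation says that \<open>\<rho>\<close> is a right action of the
  structure monoid.\<close>

lemma rho_word_struct_cong:
  assumes "solution r" and "struct_cong r u v"
  shows "rho_word r u a = rho_word r v a"
  using assms(2)
proof (induction arbitrary: a rule: struct_cong.induct)
  case (generator b c)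
  show ?case
    by (simp add: yang_baxter_right[OF assms(1)])
qed (simp_all add: rho_word_append)

lemma bij_rho_word:
  assumes "right_nondegenerate r"
  shows "bij (rho_word r w)"
proof (induction w)
  case Nil
  show ?case by (simp add: rho_word_def bij_id flip: id_def)
next
  case (Cons b w)
  have "rho_word r (b # w) = rho_word r w \<circ> rho r b"
    by (simp add: fun_eq_iff)
  moreover have "bij (rho r b)"
    using assms by (simp add: right_nondegenerate_def)
  ultimately show ?case
    using Cons.IH by (simp only: bij_comp)
qed

section \<open>Garside maps respect the relations\<close>

text \<open>On words of length \<open>n - 1\<close> following \<open>a\<close>, this is \<open>k\<^sub>n r\<^sub>n\<^sub>-\<^sub>1 \<cdots> r\<^sub>1\<close>. Recursion on the word replaces
  the positions \<open>1, \<dots>, n - 1\<close>, which would otherwise have to be shifted in every induction.\<close>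

primrec sweep :: "('a \<times> 'a \<Rightarrow> 'a \<times> 'a) \<Rightarrow> ('a \<Rightarrow> 'a) \<Rightarrow> 'a \<Rightarrow> 'a list \<Rightarrow> 'a list" where
  "sweep r k a [] = [k a]"
| "sweep r k a (b # w) = lam r a b # sweep r k (rho r b a) w"

text \<open>The prefix \<open>p\<close> consists of the strands that the moving letter has already crossed; it makes
  the coordinates of the remaining crossings fit for an induction.\<close>

lemma fold_act2_eq_sweep:
  "act1 k (length p + length w + 1)
      (fold (act2 r) [length p + 1..<length p + length w + 1] (p @ a # w)) = p @ sweep r k a w"
proof (induction w arbitrary: p a)
  case Nil
  show ?case by (simp add: act1_def)
next
  case (Cons b w)
  have step: "act2 r (length p + 1) (p @ a # b # w) = (p @ [lam r a b]) @ rho r b a # w"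
    by (simp add: act2_def lam_def rho_def split_beta nth_append list_update_append)
  have "[length p + 1..<length p + length (b # w) + 1]
      = (length p + 1) # [length (p @ [lam r a b]) + 1..<length (p @ [lam r a b]) + length w + 1]"
    by (simp add: upt_conv_Cons del: upt_Suc)
  then show ?case
    using Cons.IH[of "p @ [lam r a b]" "rho r b a"] step by (simp del: upt_Suc)
qed

lemma garside_Cons: "garside r k (a # w) = sweep r k a (garside r k w)"
  using fold_act2_eq_sweep[of k "[]" "garside r k w" r a] by simp

lemma sweep_cong:
  assumes "solution r" and "struct_cong r u v"
  shows "struct_cong r (sweep r k a u) (sweep r k a v)"
  using assms(2)
proof (induction rule: struct_cong_step_induct)
  case (step p b c b' c' s)
  have bc: "b' = lam r b c" "c' = rho r c b"
    using step by (simp_all add: lam_def rho_def)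
  show ?case
  proof (induction p arbitrary: a)
    case Nil
    \<comment> \<open>The relation between \<open>b\<close> and \<open>c\<close> reappears between the letters into which \<open>a\<close> turns them.\<close>
    have "r (lam r a b, lam r (rho r b a) c) = (lam r a b', lam r (rho r b' a) c')"
      using yang_baxter_left[OF assms(1), of a b c] yang_baxter_middle[OF assms(1), of b a c]
      by (simp add: bc lam_def rho_def prod_eq_iff)
    from struct_cong_context[OF struct_cong_pair[of r, OF this], of "[]"] show ?case
      by (simp add: bc yang_baxter_right[OF assms(1)])
  next
    case (Cons x p)
    then show ?case by (simp add: struct_cong_Cons)
  qed
qed (blast intro: struct_cong.refl struct_cong.sym struct_cong.trans)+

text \<open>The letters left behind by the two sweeps agree exactly. The only relation used is applied to
  the last two letters, after both strands have bounced, and comes from the reflection equation.\<close>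

lemma sweep_sweep_cong:
  assumes "solution r" and "reflection r k" and "r (a, b) = (c, d)"
  shows "struct_cong r (sweep r k a (sweep r k b v)) (sweep r k c (sweep r k d v))"
  using assms(3)
proof (induction v arbitrary: a b c d)
  case Nil
  from struct_cong_pair[of r, OF reflection_coordinates[OF assms(2) this]] show ?case
    by simp
next
  case (Cons x v)
  from Cons.IH[OF crossing_travels(1)[OF assms(1) Cons.prems]] show ?case
    by (simp add: crossing_travels(2)[OF assms(1) Cons.prems] struct_cong_Cons)
qed

lemma garside_struct_cong:
  assumes "solution r" and "reflection r k" and "struct_cong r u v"
  shows "struct_cong r (garside r k u) (garside r k v)"
  using assms(3)
proof (induction rule: struct_cong_step_induct)
  case (step p a b c d s)
  show ?case
  proof (induction p)
    case Nil
    show ?case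
      using sweep_sweep_cong[OF assms(1,2) step] by (simp add: garside_Cons del: garside.simps(2))
  next
    case (Cons x p)
    then show ?case
      using sweep_cong[OF assms(1)] by (simp add: garside_Cons del: garside.simps(2))
  qed
qed (blast intro: struct_cong.refl struct_cong.sym struct_cong.trans)+

section \<open>Guitar maps intertwine a solution with its derived solution\<close>

text \<open>On words of length two, the guitar map conjugates \<open>r\<close> into the derived solution; this is the
  origin of the formula for the latter.\<close>

lemma derived_solution_rho:
  assumes "right_nondegenerate r" and "r (a, b) = (c, d)"
  shows "derived_solution r k (rho r (k b) a, b) = (rho r (k d) c, d)"
proof -
  have "inj (rho r (k b))"
    using assms(1) by (simp add: right_nondegenerate_def bij_is_inj)
  then have "inv_into UNIV (rho r (k b)) (rho r (k b) a) = a"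
    by simp
  moreover have "c = lam r a b" "d = rho r b a"
    using assms(2) by (simp_all add: lam_def rho_def)
  ultimately show ?thesis
    by (simp add: derived_solution_def Let_def)
qed

text \<open>For \<open>v = \<Delta> s\<close> the two pairs are the first two entries of \<open>J (a b s)\<close> and of \<open>J (c d s)\<close>. The
  letters of \<open>v\<close> are absorbed one at a time, since the displaced strands again form a crossing.\<close>

lemma derived_solution_rho_word:
  assumes "solution r" and "right_nondegenerate r" and "r (a, b) = (c, d)"
  shows "derived_solution r k (rho_word r (sweep r k b v) a, rho_word r v b)
    = (rho_word r (sweep r k d v) c, rho_word r v d)"
  using assms(3)
proof (induction v arbitrary: a b c d)
  case Nil
  from derived_solution_rho[OF assms(2) this] show ?case
    by simp
next
  case (Cons x v)
  from Cons.IH[OF crossing_travels(1)[OF assms(1) Cons.prems]] show ?case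
    by simp
qed

text \<open>This is \<open>J r\<^sub>i = r\<^sup>(\<^sup>k\<^sup>)\<^sub>i J\<close> for \<open>i = length p + 1\<close>. The position is part of the conclusion
  because the step in \<open>r\<^sup>(\<^sup>k\<^sup>)\<close> must be located when the identity is read backwards. The prefix of \<open>J\<close>
  is unchanged as the word acting on each of its letters varies only within its class.\<close>

lemma guitar_step:
  assumes "solution r" and "right_nondegenerate r" and "reflection r k" and "r (a, b) = (c, d)"
  shows "\<exists>p' a' b' c' d' s'. length p' = length p \<and> derived_solution r k (a', b') = (c', d') \<and>
    guitar r k (p @ [a, b] @ s) = p' @ [a', b'] @ s' \<and>
    guitar r k (p @ [c, d] @ s) = p' @ [c', d'] @ s'"
proof (induction p)
  case Nil
  show ?case
    using derived_solution_rho_word[OF assms(1,2,4), of k "garside r k s"]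
    by (intro exI[of _ "[]"]) (simp add: garside_Cons del: garside.simps(2))
next
  case (Cons x p)
  then obtain p' a' b' c' d' s' where IH: "length p' = length p"
      "derived_solution r k (a', b') = (c', d')"
      "guitar r k (p @ [a, b] @ s) = p' @ [a', b'] @ s'"
      "guitar r k (p @ [c, d] @ s) = p' @ [c', d'] @ s'"
    by blast
  have "struct_cong r (garside r k (p @ [a, b] @ s)) (garside r k (p @ [c, d] @ s))"
    by (intro garside_struct_cong[OF assms(1,3)] struct_cong_context struct_cong_pair assms(4))
  then have "rho_word r (garside r k (p @ [a, b] @ s)) x = rho_word r (garside r k (p @ [c, d] @ s)) x"
    by (rule rho_word_struct_cong[OF assms(1)])
  then show ?case
    using IH
    by (intro exI[of _ "rho_word r (garside r k (p @ [a, b] @ s)) x # p'"] exI[of _ a']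
        exI[of _ b'] exI[of _ c'] exI[of _ d'] exI[of _ s']) simp
qed

lemma inj_guitar:
  assumes "right_nondegenerate r"
  shows "inj (guitar r k)"
proof (rule injI)
  show "u = v" if "guitar r k u = guitar r k v" for u v
    using that
  proof (induction u arbitrary: v)
    case Nil
    then show ?case by (cases v) auto
  next
    case (Cons a u)
    obtain b w where v: "v = b # w"
      using Cons.prems by (cases v) auto
    then have "u = w"
      using Cons by auto
    then show ?case
      using Cons.prems v bij_rho_word[OF assms, of "garside r k w"]
      by (auto dest: bij_is_inj injD)
  qed
qed

lemma surj_guitar:
  assumes "right_nondegenerate r"
  shows "surj (guitar r k)"
proof -
  have "\<exists>u. guitar r k u = v" for v
  proof (induction v)
    case Nil
    show ?case by (rule exI[of _ "[]"]) simp
  next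
    case (Cons b v)
    then obtain u where u: "guitar r k u = v"
      by blast
    obtain a where "rho_word r (garside r k u) a = b"
      using bij_is_surj[OF bij_rho_word[OF assms]] by (metis surjD)
    then show ?case
      using u by (intro exI[of _ "a # u"]) simp
  qed
  then show ?thesis
    unfolding surj_def by metis
qed

lemma guitar_struct_cong:
  assumes "solution r" and "right_nondegenerate r" and "reflection r k" and "struct_cong r u v"
  shows "struct_cong (derived_solution r k) (guitar r k u) (guitar r k v)"
  using assms(4)
proof (induction rule: struct_cong_step_induct)
  case (step p a b c d s)
  from guitar_step[OF assms(1-3) step, of p s] show ?case
    by (auto simp del: append_Cons append_Nil intro!: struct_cong_context struct_cong_pair)
qed (blast intro: struct_cong.refl struct_cong.sym struct_cong.trans)+

text \<open>A rewriting step in \<open>r\<^sup>(\<^sup>k\<^sup>)\<close> starting at \<open>J w\<close> is the image of the rewriting step in \<open>r\<close> at the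
  same place of \<open>w\<close>, so equivalences can be pulled back along the bijection \<open>J\<close>.\<close>

lemma guitar_struct_cong_reflects:
  assumes "solution r" and "right_nondegenerate r" and "reflection r k"
    and "struct_cong (derived_solution r k) (guitar r k u) (guitar r k v)"
  shows "struct_cong r u v"
proof -
  let ?J = "guitar r k" and ?J' = "inv_into UNIV (guitar r k)"
  have inv: "?J' (?J w) = w" for w
    using inj_guitar[OF assms(2)] by simp
  have "struct_cong r (?J' x) (?J' y)" if "struct_cong (derived_solution r k) x y" for x y
    using that
  proof (induction rule: struct_cong_step_induct)
    case (step p a b c d s)
    obtain w where w: "p @ [a, b] @ s = ?J w"
      using surjD[OF surj_guitar[OF assms(2)]] by blast
    have "length w = length p + Suc (Suc (length s))"
      using arg_cong[OF w, of length] by simp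
    then obtain p0 t0 where t0: "w = p0 @ t0" "length p0 = length p" "length t0 = Suc (Suc (length s))"
      by (intro that[of "take (length p) w" "drop (length p) w"]) simp_all
    then obtain a0 b0 s0 where w_split: "w = p0 @ [a0, b0] @ s0" and len: "length p0 = length p"
      by (auto simp: length_Suc_conv)
    obtain c0 d0 where r0: "r (a0, b0) = (c0, d0)"
      by fastforce
    obtain p' a' b' c' d' s' where J: "length p' = length p0"
        "derived_solution r k (a', b') = (c', d')"
        "?J w = p' @ [a', b'] @ s'" "?J (p0 @ [c0, d0] @ s0) = p' @ [c', d'] @ s'"
      using guitar_step[OF assms(1-3) r0] w_split by blast
    have "p' = p" "a' = a" "b' = b" "s' = s"
      using w J(1,3) len by auto
    then have "p @ [c, d] @ s = ?J (p0 @ [c0, d0] @ s0)"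
      using J(2,4) step by simp
    then show ?case
      using struct_cong_context[OF struct_cong_pair[of r, OF r0], of p0 s0]
      by (simp only: w inv w_split)
  qed (blast intro: struct_cong.refl struct_cong.sym struct_cong.trans)+
  from this[OF assms(4)] show ?thesis
    by (simp add: inv)
qed

section \<open>The induced maps of structure monoids\<close>

theorem proposition2p1:
  fixes r :: "'a \<times> 'a \<Rightarrow> 'a \<times> 'a" and k :: "'a \<Rightarrow> 'a"
  assumes "solution r" and "right_nondegenerate r" and "reflection r k"
  shows "(\<exists>J. bij_betw J (carrier (structure_monoid r))
                          (carrier (structure_monoid (derived_solution r k))) \<and>
              (\<forall>n. J ` degree_part r n \<subseteq> degree_part (derived_solution r k) n) \<and>
              (\<forall>w. J (word_class r w) = word_class (derived_solution r k) (guitar r k w))) \<and>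
         (\<exists>D. D \<in> carrier (structure_monoid r) \<rightarrow> carrier (structure_monoid r) \<and>
              (\<forall>n. D ` degree_part r n \<subseteq> degree_part r n) \<and>
              (\<forall>w. D (word_class r w) = word_class r (garside r k w)))"
proof (intro conjI)
  let ?r' = "derived_solution r k"
  obtain J where J: "\<And>w. J (word_class r w) = word_class ?r' (guitar r k w)"
    using word_class_map_exists[of r ?r' "guitar r k"] guitar_struct_cong[OF assms] by blast
  have "inj_on J (carrier (structure_monoid r))"
    using guitar_struct_cong_reflects[OF assms]
    by (auto simp: inj_on_def carrier_structure_monoid J word_class_eq_iff)
  moreover have "J ` carrier (structure_monoid r) = carrier (structure_monoid ?r')"
  proof -
    have "J ` range (word_class r) = word_class ?r' ` range (guitar r k)"
      by (simp add: image_image J)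
    then show ?thesis
      by (simp add: carrier_structure_monoid surj_guitar[OF assms(2)])
  qed
  ultimately have "bij_betw J (carrier (structure_monoid r)) (carrier (structure_monoid ?r'))"
    by (simp add: bij_betw_def)
  moreover have "\<forall>n. J ` degree_part r n \<subseteq> degree_part ?r' n"
    using degree_part_image_subset[of J r ?r' "guitar r k", OF J] by simp
  ultimately show "\<exists>J. bij_betw J (carrier (structure_monoid r)) (carrier (structure_monoid ?r')) \<and>
      (\<forall>n. J ` degree_part r n \<subseteq> degree_part ?r' n) \<and>
      (\<forall>w. J (word_class r w) = word_class ?r' (guitar r k w))"
    using J by blast
next
  obtain D where D: "\<And>w. D (word_class r w) = word_class r (garside r k w)"
    using word_class_map_exists[of r r "garside r k"] garside_struct_cong[OF assms(1,3)] by blast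
  have "D \<in> carrier (structure_monoid r) \<rightarrow> carrier (structure_monoid r)"
    by (auto simp: carrier_structure_monoid D)
  moreover have "\<forall>n. D ` degree_part r n \<subseteq> degree_part r n"
    using degree_part_image_subset[of D r r "garside r k", OF D] by simp
  ultimately show "\<exists>D. D \<in> carrier (structure_monoid r) \<rightarrow> carrier (structure_monoid r) \<and>
      (\<forall>n. D ` degree_part r n \<subseteq> degree_part r n) \<and>
      (\<forall>w. D (word_class r w) = word_class r (garside r k w))"
    using D by blast
qed

end
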